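(* If $G$ is a $2$-edge-connected graph of order $n$, then $\mathrm{prf}(G)\ge \frac{3n-3}{2}$.
   Context: An ordering of a graph $G=(V,E)$ is a bijection $\alpha:V\to\{1,\dots,|V|\}$. With $N[v]=\{v\}\cup\{u: uv\in E\}$, the profile of $\alpha$ is $\mathrm{prf}_\alpha(G)=\sum_{v\in V}\big(\alpha(v)-\min\{\alpha(u): u\in N[v]\}\big)$, and the profile of $G$ is $\mathrm{prf}(G)=\min_\alpha \mathrm{prf}_\alpha(G)$ over all orderings $\alpha$ of $G$. *)

theory Defs
  imports Complex_Main "Graph_Theory.Graph_Theory"
begin

text \<open>
  A finite simple graph is a symmetric digraph without loops (locale
  \<^locale>\<open>pair_graph\<close>), so an undirected edge is a pair of opposite arcs, and deleting
  it removes both arcs.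
\<close>

definition delete_edge :: "'a pair_pre_digraph \<Rightarrow> 'a \<Rightarrow> 'a \<Rightarrow> 'a pair_pre_digraph" where
  "delete_edge G u v = G\<lparr>parcs := parcs G - {(u, v), (v, u)}\<rparr>"

text \<open>
  Connectedness is that of Graph_Theory (which requires a vertex); the qualified name avoids
  the topological notion. The one-vertex graph counts as 2-edge-connected here.
\<close>

definition two_edge_connected :: "'a pair_pre_digraph \<Rightarrow> bool" where
  "two_edge_connected G \<longleftrightarrow>
     Digraph_Component.connected (with_proj G) \<and>
     (\<forall>(u, v) \<in> parcs G. Digraph_Component.connected (with_proj (delete_edge G u v)))"

definition is_ordering :: "'a pair_pre_digraph \<Rightarrow> ('a \<Rightarrow> nat) \<Rightarrow> bool" where
  "is_ordering G \<alpha> \<longleftrightarrow> bij_betw \<alpha> (pverts G) {1..card (pverts G)}"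

definition closed_nbhd :: "'a pair_pre_digraph \<Rightarrow> 'a \<Rightarrow> 'a set" where
  "closed_nbhd G v = {v} \<union> {u. (u, v) \<in> parcs G}"

text \<open>The subtraction on naturals never truncates, since \<open>v \<in> closed_nbhd G v\<close>.\<close>

definition profile_of :: "'a pair_pre_digraph \<Rightarrow> ('a \<Rightarrow> nat) \<Rightarrow> nat" where
  "profile_of G \<alpha> = (\<Sum>v\<in>pverts G. \<alpha> v - Min (\<alpha> ` closed_nbhd G v))"

text \<open>
  Orderings are total functions with arbitrary values outside \<open>pverts G\<close>, so there may be
  infinitely many of them, but they have only finitely many profiles (lemmas below).
\<close>

definition profile :: "'a pair_pre_digraph \<Rightarrow> nat" where
  "profile G = Min {profile_of G \<alpha> | \<alpha>. is_ordering G \<alpha>}"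

lemma finite_profiles: "finite {profile_of G \<alpha> | \<alpha>. is_ordering G \<alpha>}"
proof (rule finite_subset)
  show "{profile_of G \<alpha> | \<alpha>. is_ordering G \<alpha>} \<subseteq> {..card (pverts G) * card (pverts G)}"
  proof
    fix x assume "x \<in> {profile_of G \<alpha> | \<alpha>. is_ordering G \<alpha>}"
    then obtain \<alpha> where x: "x = profile_of G \<alpha>" and "is_ordering G \<alpha>" by blast
    then have le: "\<And>v. v \<in> pverts G \<Longrightarrow> \<alpha> v \<le> card (pverts G)"
      unfolding is_ordering_def bij_betw_def by auto
    have "profile_of G \<alpha> \<le> (\<Sum>v\<in>pverts G. card (pverts G))"
      unfolding profile_of_def by (rule sum_mono) (use le diff_le_self le_trans in blast)
    then show "x \<in> {..card (pverts G) * card (pverts G)}" using x by simp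
  qed
qed simp

lemma profiles_nonempty:
  assumes "finite (pverts G)"
  shows "{profile_of G \<alpha> | \<alpha>. is_ordering G \<alpha>} \<noteq> {}"
proof -
  obtain \<alpha> where "bij_betw \<alpha> (pverts G) {1..card (pverts G)}"
    using finite_same_card_bij[OF assms, of "{1..card (pverts G)}"] by auto
  then show ?thesis unfolding is_ordering_def by blast
qed

end

theory Submission
  imports Defs
begin

text \<open>
  Let \<open>w i\<close> count the vertices placed after position \<open>i\<close> that have a neighbour among the first
  \<open>i\<close>. A vertex \<open>v\<close> contributes to \<open>w i\<close> for exactly \<open>\<alpha> v - Min (\<alpha> ` closed_nbhd G v)\<close> values
  of \<open>i\<close>, so the profile is the sum of \<open>w i\<close> over \<open>1 \<le> i \<le> n - 1\<close>. As every edge cut has at least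
  two edges, \<open>w i \<ge> 1\<close>, \<open>w 1 \<ge> 2\<close>, and two consecutive values cannot both be \<open>1\<close>.
\<close>

definition boundary :: "'a pair_pre_digraph \<Rightarrow> 'a set \<Rightarrow> 'a set" where
  "boundary G S = {v \<in> pverts G - S. \<exists>u\<in>S. (u, v) \<in> parcs G}"

text \<open>A path from a vertex of \<open>S\<close> to one outside must leave \<open>S\<close> at
  some step. Library connectedness speaks of paths in \<open>mk_symmetric\<close>; the symmetry
  hypothesis turns their arcs back into arcs of \<open>G\<close>.\<close>

lemma connected_crossing_arc:
  assumes conn: "Digraph_Component.connected (with_proj G)"
    and sym: "\<And>u v. (u, v) \<in> parcs G \<Longrightarrow> (v, u) \<in> parcs G"
    and S: "S \<subseteq> pverts G" "S \<noteq> {}" "S \<noteq> pverts G"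
  obtains u v where "u \<in> S" "v \<notin> S" "(u, v) \<in> parcs G"
proof -
  obtain x y where x: "x \<in> S" and y: "y \<in> pverts G" "y \<notin> S"
    using S by blast
  have "x \<rightarrow>\<^sup>*\<^bsub>with_proj (mk_symmetric (with_proj G))\<^esub> y"
    using conn S(1) x y
    unfolding Digraph_Component.connected_def strongly_connected_def by auto
  then have "(x, y) \<in> rtrancl_on (pverts G) (parcs (mk_symmetric (with_proj G)))"
    by (simp add: reachable_def)
  \<comment> \<open>Invariant along the path: either it is still inside \<open>S\<close> or a
    crossing arc has been met.\<close>
  then have "y \<in> S \<or> (\<exists>u v. u \<in> S \<and> v \<notin> S \<and> (u, v) \<in> parcs G)"
  proof (induction rule: rtrancl_on_induct)
    case base
    then show ?case using x by blast
  next
    case (step a b)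
    from step(2) have "(a, b) \<in> parcs G"
      using sym by (auto simp: parcs_mk_symmetric)
    with step.IH show ?case by blast
  qed
  then show thesis using y that by blast
qed

text \<open>Deleting one crossing edge leaves a connected graph in which \<open>S\<close> is still a
  proper nonempty part, so another arc crosses. Both arcs point out of \<open>S\<close>, so distinct
  arcs are distinct edges.\<close>

lemma two_crossing_arcs:
  assumes G: "pair_graph G" and conn: "two_edge_connected G"
    and S: "S \<subseteq> pverts G" "S \<noteq> {}" "S \<noteq> pverts G"
  obtains u v u' v' where "u \<in> S" "v \<notin> S" "(u, v) \<in> parcs G"
    "u' \<in> S" "v' \<notin> S" "(u', v') \<in> parcs G" "(u, v) \<noteq> (u', v')"
proof -
  interpret pair_graph G by (rule G)
  have sym: "\<And>u v. (u, v) \<in> parcs G \<Longrightarrow> (v, u) \<in> parcs G"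
    using pair_sym_arcs by (auto simp: symmetric_def dest: symD)
  obtain u v where uv: "u \<in> S" "v \<notin> S" "(u, v) \<in> parcs G"
    using connected_crossing_arc[OF _ sym S] conn unfolding two_edge_connected_def by blast
  have "Digraph_Component.connected (with_proj (delete_edge G u v))"
    using conn uv(3) unfolding two_edge_connected_def by blast
  moreover have "\<And>a b. (a, b) \<in> parcs (delete_edge G u v) \<Longrightarrow> (b, a) \<in> parcs (delete_edge G u v)"
    using sym by (auto simp: delete_edge_def)
  moreover have "S \<subseteq> pverts (delete_edge G u v)" "S \<noteq> pverts (delete_edge G u v)"
    using S by (auto simp: delete_edge_def)
  ultimately obtain u' v' where "u' \<in> S" "v' \<notin> S" "(u', v') \<in> parcs (delete_edge G u v)"
    using connected_crossing_arc S(2) by metis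
  then show thesis using that uv by (auto simp: delete_edge_def)
qed

lemma card_boundary_pos:
  assumes G: "pair_graph G" and conn: "two_edge_connected G"
    and S: "S \<subseteq> pverts G" "S \<noteq> {}" "S \<noteq> pverts G"
  shows "1 \<le> card (boundary G S)"
proof -
  interpret pair_graph G by (rule G)
  obtain u v where "u \<in> S" "v \<notin> S" "(u, v) \<in> parcs G"
    using two_crossing_arcs[OF assms] by metis
  then have "v \<in> boundary G S"
    by (auto simp: boundary_def dest: in_arcsD2)
  moreover have "finite (boundary G S)"
    using pair_finite_verts by (simp add: boundary_def)
  ultimately show ?thesis
    by (metis One_nat_def Suc_leI card_gt_0_iff empty_iff)
qed

text \<open>Two distinct arcs with the common tail \<open>x\<close> have distinct heads.\<close>

lemma card_boundary_singleton:
  assumes G: "pair_graph G" and conn: "two_edge_connected G"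
    and x: "x \<in> pverts G" "{x} \<noteq> pverts G"
  shows "2 \<le> card (boundary G {x})"
proof -
  interpret pair_graph G by (rule G)
  obtain v v' where v: "v \<noteq> x" "v' \<noteq> x" "(x, v) \<in> parcs G" "(x, v') \<in> parcs G" "v \<noteq> v'"
    by (rule two_crossing_arcs[OF G conn, of "{x}"]) (use x in auto)
  then have "{v, v'} \<subseteq> boundary G {x}"
    by (auto simp: boundary_def dest: in_arcsD2)
  moreover have "finite (boundary G {x})"
    using pair_finite_verts by (simp add: boundary_def)
  ultimately have "card {v, v'} \<le> card (boundary G {x})"
    by (rule card_mono[rotated])
  then show ?thesis using v by simp
qed

text \<open>If both boundaries were singletons, a single edge would form the cut around
  \<open>insert x S\<close> or around \<open>{x}\<close>, according to whether \<open>x\<close> is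
  the boundary vertex of \<open>S\<close>.\<close>

lemma card_boundary_consecutive:
  assumes G: "pair_graph G" and conn: "two_edge_connected G"
    and S: "S \<subseteq> pverts G" "S \<noteq> {}" and x: "x \<in> pverts G" "x \<notin> S"
    and ne: "insert x S \<noteq> pverts G"
  shows "3 \<le> card (boundary G S) + card (boundary G (insert x S))"
proof (rule ccontr)
  interpret pair_graph G by (rule G)
  have sym: "\<And>u v. (u, v) \<in> parcs G \<Longrightarrow> (v, u) \<in> parcs G"
    using pair_sym_arcs by (auto simp: symmetric_def dest: symD)
  assume "\<not> ?thesis"
  moreover have "1 \<le> card (boundary G S)" "1 \<le> card (boundary G (insert x S))"
    using card_boundary_pos[OF G conn] S x ne by auto
  ultimately have "card (boundary G S) = 1" "card (boundary G (insert x S)) = 1"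
    by linarith+
  then obtain v v' where v: "boundary G S = {v}" and v': "boundary G (insert x S) = {v'}"
    by (auto simp: card_1_singleton_iff)
  have in1: "b = v" if "a \<in> S" "b \<notin> S" "(a, b) \<in> parcs G" for a b
    using that v by (auto simp: boundary_def dest: in_arcsD2)
  have in2: "b = v'" if "a \<in> insert x S" "b \<notin> insert x S" "(a, b) \<in> parcs G" for a b
    using that v' by (auto simp: boundary_def dest: in_arcsD2)
  show False
  proof (cases "x = v")
    case True
    \<comment> \<open>Every arc leaving \<open>insert x S\<close> is then the arc from \<open>x\<close> to \<open>v'\<close>, a bridge.\<close>
    have bridge: "a = x \<and> b = v'" if "a \<in> insert x S" "b \<notin> insert x S" "(a, b) \<in> parcs G" for a b
      using that in1 in2 True by blast
    show False
      by (rule two_crossing_arcs[OF G conn, of "insert x S"]) (use S x ne bridge in blast)+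
  next
    case False
    \<comment> \<open>Now \<open>x\<close> has no neighbour in \<open>S\<close> and hence \<open>v\<close> as its only neighbour.\<close>
    have "v \<in> boundary G (insert x S)"
      using v False by (auto simp: boundary_def set_eq_iff)
    then have "v' = v" using v' by simp
    \<comment> \<open>If \<open>b\<close> were in \<open>S\<close>, the reversed arc would lead from
      \<open>S\<close> to \<open>x\<close> and \<open>in1\<close> would give \<open>x = v\<close>.
      So \<open>b\<close> lies outside \<open>insert x S\<close> and \<open>in2\<close>
      applies.\<close>
    then have leaf: "b = v" if "b \<noteq> x" "(x, b) \<in> parcs G" for b
      using that in1 in2 sym False x(2) by blast
    have "{x} \<noteq> pverts G" using S x by (metis singletonI subset_singletonD)
    then show False
      using two_crossing_arcs[OF G conn, of "{x}"] x(1) leaf by (metis empty_not_insert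
        empty_subsetI insert_subset singletonD singletonI)
  qed
qed

lemma profile_of_eq_sum_boundary:
  assumes G: "pair_graph G" and ord: "is_ordering G \<alpha>"
  shows "profile_of G \<alpha> =
    (\<Sum>i = 1..card (pverts G) - 1. card (boundary G {v \<in> pverts G. \<alpha> v \<le> i}))"
proof -
  interpret pair_graph G by (rule G)
  let ?V = "pverts G" and ?I = "{1..card (pverts G) - 1}"
  let ?m = "\<lambda>v. Min (\<alpha> ` closed_nbhd G v)"
  have sym: "\<And>u v. (u, v) \<in> parcs G \<Longrightarrow> (v, u) \<in> parcs G"
    using pair_sym_arcs by (auto simp: symmetric_def dest: symD)
  have bd: "1 \<le> \<alpha> v" "\<alpha> v \<le> card ?V" if "v \<in> ?V" for v
    using ord that unfolding is_ordering_def bij_betw_def by auto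
  have sub: "closed_nbhd G v \<subseteq> ?V" if "v \<in> ?V" for v
    using that by (auto simp: closed_nbhd_def dest: in_arcsD1)
  have fin: "finite (closed_nbhd G v)" if "v \<in> ?V" for v
    using sub[OF that] pair_finite_verts by (rule finite_subset)
  have ne: "closed_nbhd G v \<noteq> {}" for v
    by (simp add: closed_nbhd_def)
  have min_le: "?m v \<le> i \<longleftrightarrow> (\<exists>u\<in>closed_nbhd G v. \<alpha> u \<le> i)" if "v \<in> ?V" for v i
    using fin[OF that] ne by (auto simp: Min_le_iff)
  have "1 \<le> ?m v" if "v \<in> ?V" for v
    using fin[OF that] ne sub[OF that] bd by (auto simp: Min_ge_iff)
  \<comment> \<open>The bounds \<open>1 \<le> ?m v\<close> and
    \<open>\<alpha> v \<le> card ?V\<close> keep the whole interval inside \<open>?I\<close>, so its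
    size is the term of \<open>v\<close> in the profile.\<close>
  then have "{i \<in> ?I. ?m v \<le> i \<and> i < \<alpha> v} = {?m v..<\<alpha> v}" if "v \<in> ?V" for v
    using bd(2)[OF that] that by fastforce
  then have "profile_of G \<alpha> = (\<Sum>v\<in>?V. card {i \<in> ?I. ?m v \<le> i \<and> i < \<alpha> v})"
    by (simp add: profile_of_def)
  \<comment> \<open>The same pairs of a vertex and a position, now counted by position.\<close>
  also have "\<dots> = (\<Sum>i\<in>?I. card {v \<in> ?V. ?m v \<le> i \<and> i < \<alpha> v})"
    by (rule sum_multicount_gen) (use pair_finite_verts in auto)
  also have "\<dots> = (\<Sum>i\<in>?I. card (boundary G {v \<in> ?V. \<alpha> v \<le> i}))"
  proof (rule sum.cong[OF refl])
    fix i
    \<comment> \<open>As \<open>i < \<alpha> v\<close>, a member of \<open>closed_nbhd G v\<close>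
      placed at or before \<open>i\<close> is not \<open>v\<close> itself, hence a
      neighbour.\<close>
    have "{v \<in> ?V. ?m v \<le> i \<and> i < \<alpha> v} = boundary G {v \<in> ?V. \<alpha> v \<le> i}"
      using min_le in_arcsD1 unfolding boundary_def closed_nbhd_def by fastforce
    then show "card {v \<in> ?V. ?m v \<le> i \<and> i < \<alpha> v} = card (boundary G {v \<in> ?V. \<alpha> v \<le> i})"
      by simp
  qed
  finally show ?thesis .
qed

text \<open>Terms are paired from the top, each pair giving at least 3. For odd \<open>m\<close> the
  term \<open>w 1\<close> is left over, and it is at least 2.\<close>

lemma sum_ge_if_no_consecutive_ones:
  fixes w :: "nat \<Rightarrow> nat"
  assumes "1 \<le> m \<Longrightarrow> 2 \<le> w 1"
    and "\<And>i. 1 \<le> i \<Longrightarrow> Suc i \<le> m \<Longrightarrow> 3 \<le> w i + w (Suc i)"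
  shows "3 * m \<le> 2 * (\<Sum>i = 1..m. w i)"
  using assms
proof (induction m rule: induct_nat_012)
  case (ge2 m)
  have "3 * m \<le> 2 * (\<Sum>i = 1..m. w i)"
    by (rule ge2.IH(1)) (use ge2.prems in auto)
  moreover have "3 \<le> w (Suc m) + w (Suc (Suc m))"
    using ge2.prems(2)[of "Suc m"] by simp
  ultimately show ?case by simp
qed simp_all

lemma profile_of_ge:
  assumes G: "pair_graph G" and conn: "two_edge_connected G" and ord: "is_ordering G \<alpha>"
  shows "3 * (card (pverts G) - 1) \<le> 2 * profile_of G \<alpha>"
proof -
  interpret pair_graph G by (rule G)
  let ?V = "pverts G" and ?S = "\<lambda>i. {v \<in> pverts G. \<alpha> v \<le> i}"
  have \<alpha>: "inj_on \<alpha> ?V" "\<alpha> ` ?V = {1..card ?V}"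
    using ord by (auto simp: is_ordering_def bij_betw_def)
  have pos: "1 \<le> \<alpha> v" if "v \<in> ?V" for v
    using \<alpha>(2) that by auto
  have at: "\<exists>x\<in>?V. \<alpha> x = i" if "1 \<le> i" "i \<le> card ?V" for i
    using \<alpha>(2) that by (metis atLeastAtMost_iff imageE)
  \<comment> \<open>The vertex in the last position is missing from \<open>?S i\<close>.\<close>
  have proper: "?S i \<noteq> ?V" if "i < card ?V" for i
    using at[of "card ?V"] that by force
  have step: "\<exists>x\<in>?V. x \<notin> ?S i \<and> ?S (Suc i) = insert x (?S i)" if le: "Suc i \<le> card ?V" for i
  proof -
    obtain x where x: "x \<in> ?V" "\<alpha> x = Suc i" using at[of "Suc i"] le by auto
    then have "?S (Suc i) = insert x (?S i)"
      using \<alpha>(1) by (auto simp: le_Suc_eq inj_on_def)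
    then show ?thesis using x by (intro bexI[of _ x]) auto
  qed
  have "3 * (card ?V - 1) \<le> 2 * (\<Sum>i = 1..card ?V - 1. card (boundary G (?S i)))"
  proof (rule sum_ge_if_no_consecutive_ones)
    assume m: "1 \<le> card ?V - 1"
    then have "Suc 0 \<le> card ?V" by linarith
    from step[OF this] obtain x where x: "x \<in> ?V" "?S (Suc 0) = insert x (?S 0)"
      by blast
    \<comment> \<open>Positions start at 1, so the first nonempty prefix is a single vertex.\<close>
    moreover have "?S 0 = {}" using pos by fastforce
    ultimately have S1: "?S 1 = {x}" by (simp only: One_nat_def)
    moreover have "?S 1 \<noteq> ?V" using m by (intro proper) linarith
    ultimately show "2 \<le> card (boundary G (?S 1))"
      using card_boundary_singleton[OF G conn x(1)] by metis
  next
    fix i assume i: "1 \<le> i" "Suc i \<le> card ?V - 1"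
    then have lt: "Suc i < card ?V" by linarith
    obtain x where x: "x \<in> ?V" "x \<notin> ?S i" "?S (Suc i) = insert x (?S i)"
      using step[OF less_imp_le[OF lt]] by blast
    have "?S i \<noteq> {}" using at[of i] i lt by force
    then show "3 \<le> card (boundary G (?S i)) + card (boundary G (?S (Suc i)))"
      using card_boundary_consecutive[OF G conn, of "?S i" x] x(1,2) proper[OF lt]
      unfolding x(3) by blast
  qed
  then show ?thesis by (simp only: profile_of_eq_sum_boundary[OF G ord])
qed

theorem theorem2p5:
  fixes G :: "'a pair_pre_digraph" and n :: nat
  assumes "pair_graph G"
    and "two_edge_connected G"
    and "n = card (pverts G)"
  shows "real (profile G) \<ge> (3 * real n - 3) / 2"
proof -
  interpret pair_graph G by (rule assms(1))
  have "profile G \<in> {profile_of G \<alpha> | \<alpha>. is_ordering G \<alpha>}"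
    unfolding profile_def
    by (rule Min_in[OF finite_profiles profiles_nonempty[OF pair_finite_verts]])
  then have "3 * (n - 1) \<le> 2 * profile G"
    using profile_of_ge[OF assms(1,2)] assms(3) by auto
  \<comment> \<open>Adding 3 on the right removes the truncated subtraction, since
    \<open>3 * n \<le> 3 * (n - 1) + 3\<close> for every natural \<open>n\<close>.\<close>
  then have "real (3 * n) \<le> real (2 * profile G + 3)" by linarith
  then show ?thesis by simp
qed

end
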